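(* Let $G=\langle N,v\rangle$ be a cooperative game (with $v$ non-negative, super-additive, essential and $(0,1)$-normalised). Then $G$ has a non-empty supercore if and only if $G$ is balanced.
   Context: Let $N=\{1,\dots,m\}$ with $m\ge 1$. A coalition is a subset of $N$. A cooperative game is a pair $G=\langle N,v\rangle$ with $v:\mathcal{P}(N)\to\mathbb{R}$, $v(\varnothing)=0$. $v$ is non-negative if $v(C)\ge 0$ for all $C\subseteq N$; super-additive if $v(C\cup C')\ge v(C)+v(C')$ for all disjoint $C,C'\subseteq N$; essential if $\sum_{k=1}^m v(\{k\})\neq v(N)$; $(0,1)$-normalised if $v(\{k\})=0$ for all $k\in N$ and $v(N)=1$. An imputation is a vector $\mathbf{x}=(x_1,\dots,x_m)\in\mathbb{R}^m$ with $\sum_{k\in N}x_k=v(N)$ and $x_k\ge v(\{k\})$ for all $k\in N$; $\mathrm{IMP}$ denotes the set of imputations. For a coalition $C$ and $\mathbf{x},\mathbf{y}\in \mathrm{IMP}$, write $\mathbf{x}\to_C\mathbf{y}$ iff $x_k>y_k$ for all $k\in C$ and $\sum_{k\in C}x_k\le v(C)$. Write $\mathbf{x}\to\mathbf{y}$ iff $\mathbf{x}\to_C\mathbf{y}$ for some nonempty $C\subseteq N$. The abstract game of $G$ is the directed graph $\langle \mathrm{IMP},\to\rangle$. For $S\subseteq \mathrm{IMP}$ let $u(S)=\mathrm{IMP}\setminus\{\mathbf{y}:\exists \mathbf{x}\in S,\ \mathbf{x}\to\mathbf{y}\}$. A subsolution of $G$ is a set $S\subseteq \mathrm{IMP}$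 with $S\subseteq u(S)$ and $S=u(u(S))$. The supercore of $G$ is the intersection of all its subsolutions. A function $f:\mathcal{P}(N)\to[0,1]$ is balanced iff for every $k\in N$, $\sum_{S\subseteq N\setminus\{k\}}f(S\cup\{k\})=1$. The game $G$ is balanced iff for every balanced function $f$, $\sum_{S\subseteq N}f(S)v(S)\le v(N)$. *)

theory Defs
  imports "HOL-Analysis.Analysis"
begin

text \<open>
  The player set $N = \{1,\dots,m\}$, $m \ge 1$, is rendered as the universe of an arbitrary
  finite type \<^typ>\<open>'n\<close>, with $m$ = \<^term>\<open>CARD('n)\<close>.  Coalitions are elements of
  \<^typ>\<open>'n set\<close>, and vectors in $R^m$ are elements of \<^typ>\<open>real ^ 'n\<close>.
  A game is given by its characteristic function \<open>v\<close>.
\<close>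

definition cooperative_game :: "('n::finite set \<Rightarrow> real) \<Rightarrow> bool" where
  "cooperative_game v \<longleftrightarrow> v {} = 0"

definition nonnegative_game :: "('n::finite set \<Rightarrow> real) \<Rightarrow> bool" where
  "nonnegative_game v \<longleftrightarrow> (\<forall>C. 0 \<le> v C)"

definition superadditive_game :: "('n::finite set \<Rightarrow> real) \<Rightarrow> bool" where
  "superadditive_game v \<longleftrightarrow> (\<forall>C C'. C \<inter> C' = {} \<longrightarrow> v C + v C' \<le> v (C \<union> C'))"

definition essential_game :: "('n::finite set \<Rightarrow> real) \<Rightarrow> bool" where
  "essential_game v \<longleftrightarrow> (\<Sum>k\<in>UNIV. v {k}) \<noteq> v UNIV"

definition normalised_game :: "('n::finite set \<Rightarrow> real) \<Rightarrow> bool" where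
  "normalised_game v \<longleftrightarrow> (\<forall>k. v {k} = 0) \<and> v UNIV = 1"

definition IMP :: "('n::finite set \<Rightarrow> real) \<Rightarrow> (real ^ 'n) set" where
  "IMP v = {x. (\<Sum>k\<in>UNIV. x $ k) = v UNIV \<and> (\<forall>k. v {k} \<le> x $ k)}"

definition dominates_via ::
    "('n::finite set \<Rightarrow> real) \<Rightarrow> 'n set \<Rightarrow> real ^ 'n \<Rightarrow> real ^ 'n \<Rightarrow> bool" where
  "dominates_via v C x y \<longleftrightarrow>
     x \<in> IMP v \<and> y \<in> IMP v \<and> (\<forall>k\<in>C. y $ k < x $ k) \<and> (\<Sum>k\<in>C. x $ k) \<le> v C"

definition dominates :: "('n::finite set \<Rightarrow> real) \<Rightarrow> real ^ 'n \<Rightarrow> real ^ 'n \<Rightarrow> bool" where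
  "dominates v x y \<longleftrightarrow> (\<exists>C. C \<noteq> {} \<and> dominates_via v C x y)"

definition undominated_by ::
    "('n::finite set \<Rightarrow> real) \<Rightarrow> (real ^ 'n) set \<Rightarrow> (real ^ 'n) set" where
  "undominated_by v S = IMP v - {y. \<exists>x\<in>S. dominates v x y}"

definition subsolution :: "('n::finite set \<Rightarrow> real) \<Rightarrow> (real ^ 'n) set \<Rightarrow> bool" where
  "subsolution v S \<longleftrightarrow>
     S \<subseteq> IMP v \<and> S \<subseteq> undominated_by v S \<and> S = undominated_by v (undominated_by v S)"

definition supercore :: "('n::finite set \<Rightarrow> real) \<Rightarrow> (real ^ 'n) set" where
  "supercore v = \<Inter> {S. subsolution v S}"

text \<open>
  The intersection above is never taken over the empty family, so it is always a set of
  imputations.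
\<close>

lemma subsolution_exists: "\<exists>S. subsolution v S"
proof -
  let ?u = "undominated_by v"
  define S where "S = lfp (\<lambda>X. ?u (?u X))"
  have anti: "?u B \<subseteq> ?u A" if "A \<subseteq> B" for A B
    using that by (auto simp: undominated_by_def)
  have "mono (\<lambda>X. ?u (?u X))"
    by (intro monoI anti)
  then have fp: "S = ?u (?u S)"
    unfolding S_def by (rule lfp_unfold)
  then have "?u (?u (?u S)) \<subseteq> ?u S"
    by simp
  then have "S \<subseteq> ?u S"
    unfolding S_def by (rule lfp_lowerbound)
  moreover have "?u S \<subseteq> IMP v"
    by (auto simp: undominated_by_def)
  ultimately show ?thesis
    using fp unfolding subsolution_def by blast
qed

lemma supercore_subset_IMP: "supercore v \<subseteq> IMP v"
  using subsolution_exists[of v] by (auto simp: supercore_def subsolution_def)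

definition balanced_function :: "('n::finite set \<Rightarrow> real) \<Rightarrow> bool" where
  "balanced_function f \<longleftrightarrow>
     (\<forall>S. f S \<in> {0..1}) \<and> (\<forall>k. (\<Sum>S\<in>Pow (UNIV - {k}). f (S \<union> {k})) = 1)"

definition balanced_game :: "('n::finite set \<Rightarrow> real) \<Rightarrow> bool" where
  "balanced_game v \<longleftrightarrow>
     (\<forall>f. balanced_function f \<longrightarrow> (\<Sum>S\<in>Pow UNIV. f S * v S) \<le> v UNIV)"

end

theory Submission
  imports Defs
begin

text \<open>
  The supercore is the least fixed point of the square of the undomination operator $u$, so it is
  empty exactly when $u(u(\emptyset)) = u(\mathrm{IMP})$, the set of undominated imputations, is
  empty.  Under super-additivity this set is the core: a coalition $C$ that receives less
  than $v(C)$ can share the deficit equally among its members, and what is left of $v(N)$ still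
  covers the individual claims of the other players.  That the core is non-empty if and only if
  the game is balanced is the Bondareva--Shapley theorem, an instance of Farkas' lemma.
\<close>

definition core :: "('n::finite set \<Rightarrow> real) \<Rightarrow> (real ^ 'n) set" where
  "core v = {x \<in> IMP v. \<forall>C. v C \<le> (\<Sum>k\<in>C. x $ k)}"

subsection \<open>The supercore as a least fixed point\<close>

lemma undominated_by_subset_IMP: "undominated_by v S \<subseteq> IMP v"
  by (auto simp: undominated_by_def)

lemma undominated_by_antimono: "A \<subseteq> B \<Longrightarrow> undominated_by v B \<subseteq> undominated_by v A"
  by (auto simp: undominated_by_def)

lemma undominated_by_empty: "undominated_by v {} = IMP v"
  by (auto simp: undominated_by_def)

text \<open>Write u for \<open>undominated_by v\<close>. For a subsolution S, u(S) lies in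
  \<open>IMP v\<close>, so antitonicity gives u(IMP) \<subseteq> u(u(S)) = S; hence u(IMP) lies in
  the supercore. If u(IMP) is empty, then \<open>{}\<close> is itself a subsolution, because u({}) =
  IMP.\<close>

lemma supercore_eq_empty_iff: "supercore v = {} \<longleftrightarrow> undominated_by v (IMP v) = {}"
proof
  assume "supercore v = {}"
  have "undominated_by v (IMP v) \<subseteq> S" if "subsolution v S" for S
  proof -
    have "undominated_by v (IMP v) \<subseteq> undominated_by v (undominated_by v S)"
      by (rule undominated_by_antimono[OF undominated_by_subset_IMP])
    also have "\<dots> = S"
      using that unfolding subsolution_def by (elim conjE) (rule sym)
    finally show ?thesis .
  qed
  then have "undominated_by v (IMP v) \<subseteq> supercore v"
    by (auto simp: supercore_def)
  with \<open>supercore v = {}\<close> show "undominated_by v (IMP v) = {}"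
    by simp
next
  assume "undominated_by v (IMP v) = {}"
  then have "subsolution v {}"
    by (simp add: subsolution_def undominated_by_empty)
  then show "supercore v = {}"
    by (auto simp: supercore_def)
qed

subsection \<open>Undominated imputations\<close>

lemma sum_singletons_le:
  fixes v :: "'n::finite set \<Rightarrow> real"
  assumes "cooperative_game v" "superadditive_game v"
  shows "(\<Sum>k\<in>C. v {k}) \<le> v C"
  using finite[of C]
proof (induction C rule: finite_induct)
  case empty
  then show ?case
    using assms(1) by (simp add: cooperative_game_def)
next
  case (insert k C)
  then have "{k} \<inter> C = {}"
    by simp
  then have "v {k} + v C \<le> v ({k} \<union> C)"
    using assms(2) by (simp only: superadditive_game_def)
  with insert show ?case
    by simp
qed

lemma undominated_eq_core:
  fixes v :: "'n::finite set \<Rightarrow> real"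
  assumes coop: "cooperative_game v" and super: "superadditive_game v"
  shows "undominated_by v (IMP v) = core v"
proof
  show "core v \<subseteq> undominated_by v (IMP v)"
  proof
    fix x assume x: "x \<in> core v"
    have False if dom: "dominates v y x" for y
    proof -
      obtain C where C: "C \<noteq> {}" "\<forall>k\<in>C. x $ k < y $ k" "(\<Sum>k\<in>C. y $ k) \<le> v C"
        using dom by (auto simp: dominates_def dominates_via_def)
      then have "(\<Sum>k\<in>C. x $ k) < (\<Sum>k\<in>C. y $ k)"
        by (intro sum_strict_mono) auto
      moreover have "v C \<le> (\<Sum>k\<in>C. x $ k)"
        using x by (simp add: core_def)
      ultimately show False
        using C(3) by simp
    qed
    with x show "x \<in> undominated_by v (IMP v)"
      by (auto simp: undominated_by_def core_def)
  qed
next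
  show "undominated_by v (IMP v) \<subseteq> core v"
  proof
    fix x assume x: "x \<in> undominated_by v (IMP v)"
    then have ximp: "x \<in> IMP v"
      by (simp add: undominated_by_def)
    have "v C \<le> (\<Sum>k\<in>C. x $ k)" for C
    proof (rule ccontr)
      assume less: "\<not> v C \<le> (\<Sum>k\<in>C. x $ k)"
      define e where "e = v C - (\<Sum>k\<in>C. x $ k)"
      have e: "0 < e"
        using less by (simp add: e_def)
      \<comment> \<open>The empty and the grand coalition have no deficit: the components of
        \<open>x\<close> over them sum to 0 and to \<open>v UNIV\<close>.\<close>
      have C: "C \<noteq> {}" "C \<noteq> UNIV"
        using less coop ximp by (auto simp: cooperative_game_def IMP_def)
      then have C': "- C \<noteq> {}"
        by blast
      have card: "0 < card C" "0 < card (- C)"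
        using C C' by (simp_all add: card_gt_0_iff)
      \<comment> \<open>\<open>r\<close> is the surplus once \<open>C\<close> has received
        \<open>v C\<close> and every outsider its individual worth; super-additivity makes it
        non-negative.\<close>
      define r where "r = v UNIV - v C - (\<Sum>k\<in>-C. v {k})"
      have "v C + v (- C) \<le> v UNIV"
        using super by (metis Compl_disjoint Compl_partition superadditive_game_def)
      then have r: "0 \<le> r"
        using sum_singletons_le[OF coop super, of "- C"] by (simp add: r_def)
      define y :: "real ^ 'n" where
        "y = (\<chi> k. if k \<in> C then x $ k + e / card C else v {k} + r / card (- C))"
      have "(\<Sum>k\<in>C. y $ k) = (\<Sum>k\<in>C. x $ k + e / card C)"
        by (simp add: y_def)
      then have yC: "(\<Sum>k\<in>C. y $ k) = v C"
        using C by (simp add: sum.distrib e_def)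
      have "(\<Sum>k\<in>-C. y $ k) = (\<Sum>k\<in>-C. v {k} + r / card (- C))"
        by (simp add: y_def)
      then have "(\<Sum>k\<in>-C. y $ k) = v UNIV - v C"
        using C' by (simp add: sum.distrib r_def)
      with yC have "(\<Sum>k\<in>UNIV. y $ k) = v UNIV"
        using sum.subset_diff[of C UNIV "\<lambda>k. y $ k"] by (simp add: Compl_eq_Diff_UNIV)
      moreover have "v {k} \<le> y $ k" for k
        using ximp e r by (auto simp: y_def IMP_def intro: add_increasing2)
      ultimately have "y \<in> IMP v"
        by (simp add: IMP_def)
      moreover have "\<forall>k\<in>C. x $ k < y $ k"
        using e card by (simp add: y_def)
      ultimately have "dominates v y x"
        using ximp yC C(1) unfolding dominates_def dominates_via_def by (metis order_refl)
      with \<open>y \<in> IMP v\<close> x show False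
        by (auto simp: undominated_by_def)
    qed
    with ximp show "x \<in> core v"
      by (simp add: core_def)
  qed
qed

subsection \<open>The Bondareva--Shapley theorem\<close>

text \<open>The convex cone generated by finitely many vectors is closed, so a point
  \<open>z\<close> outside it can be strictly separated from it. Since the cone contains 0 and is
  closed under non-negative scaling, the separating functional is negative at \<open>z\<close> and
  non-negative on every generator.\<close>

lemma farkas:
  fixes g :: "'i \<Rightarrow> 'a::euclidean_space"
  assumes I: "finite I"
    and infeasible: "\<And>c. (\<And>i. i \<in> I \<Longrightarrow> 0 \<le> c i) \<Longrightarrow> (\<Sum>i\<in>I. c i *\<^sub>R g i) \<noteq> z"
  obtains a where "a \<bullet> z < 0" "\<And>i. i \<in> I \<Longrightarrow> 0 \<le> a \<bullet> g i"
proof -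
  define K where "K = {\<Sum>i\<in>I. c i *\<^sub>R g i | c :: 'i \<Rightarrow> real. \<forall>i\<in>I. 0 \<le> c i}"
  let ?H = "convex_cone hull (g ` I)"
  have "?H \<subseteq> K"
  proof (rule hull_minimal)
    show "g ` I \<subseteq> K"
    proof
      fix y assume "y \<in> g ` I"
      then obtain j where j: "j \<in> I" "y = g j"
        by blast
      have "(\<Sum>i\<in>I. (if i = j then 1 else 0 :: real) *\<^sub>R g i) = (\<Sum>i\<in>I. if i = j then g i else 0)"
        by (rule sum.cong) auto
      also have "\<dots> = y"
        using j I by (simp add: sum.delta)
      finally show "y \<in> K"
        unfolding K_def by (intro CollectI exI[of _ "\<lambda>i. if i = j then 1 else 0"]) auto
    qed
    show "convex_cone K"
      unfolding convex_cone_iff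
    proof (intro conjI ballI allI impI)
      show "0 \<in> K"
        unfolding K_def by (intro CollectI exI[of _ "\<lambda>_. 0"]) auto
    next
      fix x y assume "x \<in> K" "y \<in> K"
      then obtain c d where c: "\<forall>i\<in>I. 0 \<le> c i" "x = (\<Sum>i\<in>I. c i *\<^sub>R g i)"
        and d: "\<forall>i\<in>I. 0 \<le> d i" "y = (\<Sum>i\<in>I. d i *\<^sub>R g i)"
        unfolding K_def by blast
      then show "x + y \<in> K"
        unfolding K_def
        by (intro CollectI exI[of _ "\<lambda>i. c i + d i"]) (auto simp: sum.distrib scaleR_add_left)
    next
      fix x and t :: real assume "x \<in> K" "0 \<le> t"
      then obtain c where c: "\<forall>i\<in>I. 0 \<le> c i" "x = (\<Sum>i\<in>I. c i *\<^sub>R g i)"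
        unfolding K_def by blast
      with \<open>0 \<le> t\<close> show "t *\<^sub>R x \<in> K"
        unfolding K_def
        by (intro CollectI exI[of _ "\<lambda>i. t * c i"]) (auto simp: scaleR_sum_right)
    qed
  qed
  moreover have "z \<notin> K"
    using infeasible unfolding K_def by blast
  ultimately have "z \<notin> ?H"
    by blast
  moreover have "closed ?H" "convex ?H"
    using I by (simp_all add: closed_convex_cone_hull convex_convex_cone_hull)
  ultimately obtain a b where ab: "a \<bullet> z < b" "\<forall>x\<in>?H. b < a \<bullet> x"
    using separating_hyperplane_closed_point by metis
  have "b < 0"
    using ab(2) convex_cone_hull_contains_0 by force
  show ?thesis
  proof (rule that)
    show "a \<bullet> z < 0"
      using ab(1) \<open>b < 0\<close> by simp
    fix i assume "i \<in> I"
    show "0 \<le> a \<bullet> g i"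
    proof (rule ccontr)
      \<comment> \<open>otherwise a large multiple of \<open>g i\<close> would cross the separating hyperplane\<close>
      assume neg: "\<not> 0 \<le> a \<bullet> g i"
      define t where "t = b / (a \<bullet> g i)"
      have "0 \<le> t"
        using neg \<open>b < 0\<close> by (simp add: t_def divide_nonpos_nonpos)
      then have "t *\<^sub>R g i \<in> ?H"
        using \<open>i \<in> I\<close> by (intro convex_cone_hull_mul hull_inc) auto
      then have "b < a \<bullet> (t *\<^sub>R g i)"
        using ab(2) by blast
      with neg show False
        by (simp add: t_def)
    qed
  qed
qed

lemma sum_coalitions_containing:
  fixes f :: "'n::finite set \<Rightarrow> real"
  shows "(\<Sum>S\<in>Pow (UNIV - {k}). f (S \<union> {k})) = (\<Sum>S | k \<in> S. f S)"
  by (rule sum.reindex_bij_witness[of _ "\<lambda>S. S - {k}" "\<lambda>S. S \<union> {k}"]) auto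

text \<open>Double counting: weight the core inequality of each coalition by \<open>f\<close> and
  exchange the sums. Balancedness of \<open>f\<close> gives every \<open>x $ k\<close> total weight
  1, which leaves \<open>v UNIV\<close>.\<close>

lemma balanced_if_core_nonempty:
  fixes v :: "'n::finite set \<Rightarrow> real"
  assumes x: "x \<in> core v"
  shows "balanced_game v"
  unfolding balanced_game_def
proof (intro allI impI)
  fix f :: "'n set \<Rightarrow> real" assume f: "balanced_function f"
  have f1: "(\<Sum>S | k \<in> S. f S) = 1" for k
    using f by (simp only: balanced_function_def sum_coalitions_containing)
  have "(\<Sum>S\<in>UNIV. f S * v S) \<le> (\<Sum>S\<in>UNIV. f S * (\<Sum>k\<in>S. x $ k))"
    using f x by (intro sum_mono mult_left_mono) (auto simp: balanced_function_def core_def)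
  also have "\<dots> = (\<Sum>S\<in>UNIV. \<Sum>k | k \<in> UNIV \<and> k \<in> S. f S * x $ k)"
    by (simp add: sum_distrib_left)
  also have "\<dots> = (\<Sum>k\<in>UNIV. \<Sum>S | S \<in> UNIV \<and> k \<in> S. f S * x $ k)"
    by (rule sum.swap_restrict) auto
  also have "\<dots> = (\<Sum>k\<in>UNIV. x $ k)"
    using f1 by (simp flip: sum_distrib_right)
  also have "\<dots> = v UNIV"
    using x by (simp add: core_def IMP_def)
  finally show "(\<Sum>S\<in>Pow UNIV. f S * v S) \<le> v UNIV"
    by simp
qed

text \<open>Farkas' lemma with target (0, 1): a representation of the target would, after rescaling,
  be a balanced function of value above \<open>v UNIV\<close>. The separating functional, normalised
  by its last component, is therefore a core element.\<close>

lemma core_nonempty_if_balanced: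
  fixes v :: "'n::finite set \<Rightarrow> real"
  assumes coop: "cooperative_game v" and bal: "balanced_game v"
  shows "core v \<noteq> {}"
proof -
  define ind :: "'n set \<Rightarrow> real ^ 'n" where "ind S = (\<chi> k. if k \<in> S then 1 else 0)" for S
  have inner_ind: "x \<bullet> ind S = (\<Sum>k\<in>S. x $ k)" for x S
    by (simp add: inner_vec_def ind_def if_distrib sum.If_cases cong: if_cong)
  \<comment> \<open>The \<open>None\<close> generator encodes the reverse inequality for the grand coalition.\<close>
  define g :: "'n set option \<Rightarrow> (real ^ 'n) \<times> real" where
    "g i = (case i of Some S \<Rightarrow> (ind S, v S) | None \<Rightarrow> (- ind UNIV, - v UNIV))" for i
  have infeasible: "(\<Sum>i\<in>UNIV. c i *\<^sub>R g i) \<noteq> (0, 1)" if c: "\<And>i. 0 \<le> c i" for c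
  proof
    assume eq: "(\<Sum>i\<in>UNIV. c i *\<^sub>R g i) = (0, 1)"
    define l where "l = c None"
    define f where "f S = c (Some S)" for S
    have l: "0 \<le> l" and f: "0 \<le> f S" for S
      using c by (auto simp: l_def f_def)
    have "(\<Sum>i\<in>UNIV. c i *\<^sub>R g i) = c None *\<^sub>R g None + (\<Sum>S\<in>UNIV. c (Some S) *\<^sub>R g (Some S))"
      by (simp add: UNIV_option_conv sum.reindex)
    also have "\<dots> = ((\<Sum>S\<in>UNIV. f S *\<^sub>R ind S) - l *\<^sub>R ind UNIV,
        (\<Sum>S\<in>UNIV. f S * v S) - l * v UNIV)"
      by (simp add: g_def l_def f_def prod_eq_iff fst_sum snd_sum)
    finally have vec: "(\<Sum>S\<in>UNIV. f S *\<^sub>R ind S) = l *\<^sub>R ind UNIV"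
      and val: "(\<Sum>S\<in>UNIV. f S * v S) = l * v UNIV + 1"
      using eq by auto
    \<comment> \<open>Componentwise, \<open>vec\<close> says that every player is covered with the
      same total weight \<open>l\<close>; division by \<open>l\<close> will turn this into the
      balancing condition.\<close>
    have cover: "(\<Sum>S | k \<in> S. f S) = l" for k
    proof -
      have "(\<Sum>S | k \<in> S. f S) = (\<Sum>S\<in>UNIV. f S *\<^sub>R ind S) $ k"
        by (simp add: ind_def flip: of_bool_def)
      also have "\<dots> = l"
        unfolding vec by (simp add: ind_def)
      finally show ?thesis .
    qed
    \<comment> \<open>This yields the upper bound 1 after division by \<open>l\<close>, and for
      \<open>l = 0\<close> it makes all weights of non-empty coalitions vanish.\<close>
    have f_le: "f S \<le> l" if "S \<noteq> {}" for S
    proof -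
      obtain k where "k \<in> S"
        using \<open>S \<noteq> {}\<close> by blast
      then show ?thesis
        using member_le_sum[of S "{S. k \<in> S}" f] f cover[of k] by simp
    qed
    show False
    proof (cases "l = 0")
      case True
      then have "f S * v S = 0" for S
        using f_le[of S] f[of S] coop by (cases "S = {}") (auto simp: cooperative_game_def)
      then have "(\<Sum>S\<in>UNIV. f S * v S) = 0"
        by (intro sum.neutral) blast
      then show False
        using val True by simp
    next
      case False
      with l have "0 < l"
        by simp
      \<comment> \<open>The weight of \<open>{}\<close> may exceed 1; it contributes nothing and is reset to 0.\<close>
      define h where "h S = (if S = {} then 0 else f S / l)" for S
      have "(\<Sum>S | k \<in> S. h S) = 1" for k
      proof -
        have "(\<Sum>S | k \<in> S. h S) = (\<Sum>S | k \<in> S. f S / l)"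
          by (rule sum.cong) (auto simp: h_def)
        then show ?thesis
          using cover[of k] False by (simp flip: sum_divide_distrib)
      qed
      moreover have "h S \<in> {0..1}" for S
        using f f_le \<open>0 < l\<close> by (auto simp: h_def)
      ultimately have "balanced_function h"
        by (simp only: balanced_function_def sum_coalitions_containing) auto
      then have "(\<Sum>S\<in>UNIV. h S * v S) \<le> v UNIV"
        using bal by (simp add: balanced_game_def)
      moreover have "h S * v S = f S * v S / l" for S
        using coop by (simp add: h_def cooperative_game_def)
      ultimately have "(\<Sum>S\<in>UNIV. f S * v S) / l \<le> v UNIV"
        by (simp add: sum_divide_distrib)
      \<comment> \<open>By \<open>val\<close> the left-hand side is \<open>v UNIV + 1 / l\<close>,
        which exceeds \<open>v UNIV\<close>.\<close>
      with val \<open>0 < l\<close> show False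
        by (simp add: field_simps)
    qed
  qed
  obtain a where a: "a \<bullet> (0, 1) < 0" "\<And>i. 0 \<le> a \<bullet> g i"
    by (rule farkas[OF finite[of UNIV], of g "(0, 1)"]) (use infeasible that in blast)+
  \<comment> \<open>The negative value at (0, 1) is the last component of \<open>a\<close>, so
    \<open>t\<close> is positive and \<open>fst a\<close> satisfies the core inequalities scaled by
    \<open>t\<close>.\<close>
  define t where "t = - snd a"
  have t: "0 < t"
    using a(1) by (simp add: t_def inner_prod_def)
  have ge: "t * v S \<le> (\<Sum>k\<in>S. fst a $ k)" for S
    using a(2)[of "Some S"] by (simp add: g_def t_def inner_prod_def inner_ind)
  have le: "(\<Sum>k\<in>UNIV. fst a $ k) \<le> t * v UNIV"
    using a(2)[of None] by (simp add: g_def t_def inner_prod_def inner_ind)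
  define x where "x = (1 / t) *\<^sub>R fst a"
  have sum_x: "(\<Sum>k\<in>S. x $ k) = (\<Sum>k\<in>S. fst a $ k) / t" for S
    by (simp add: x_def sum_divide_distrib)
  have core: "v S \<le> (\<Sum>k\<in>S. x $ k)" for S
    using ge[of S] t by (simp add: sum_x field_simps)
  moreover have "(\<Sum>k\<in>UNIV. x $ k) = v UNIV"
    using core[of UNIV] le t by (simp add: sum_x field_simps)
  moreover have "v {k} \<le> x $ k" for k
    using core[of "{k}"] by simp
  ultimately have "x \<in> core v"
    by (simp add: core_def IMP_def)
  then show ?thesis
    by blast
qed

theorem corollary3:
  fixes v :: "'n::finite set \<Rightarrow> real"
  assumes "cooperative_game v"
    and "nonnegative_game v"
    and "superadditive_game v"
    and "essential_game v"
    and "normalised_game v"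
  shows "supercore v \<noteq> {} \<longleftrightarrow> balanced_game v"
proof -
  have "supercore v \<noteq> {} \<longleftrightarrow> core v \<noteq> {}"
    using assms(1,3) by (simp add: supercore_eq_empty_iff undominated_eq_core)
  also have "\<dots> \<longleftrightarrow> balanced_game v"
    using assms(1) core_nonempty_if_balanced balanced_if_core_nonempty by blast
  finally show ?thesis .
qed

end
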